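(* For every $x_0\in\mathbb R$ and every $\rho>\frac4\pi$, $$H(x_0,\rho)=\frac1{\rho^2}\,\mathbb J_{x_0}(-x_0)+R,\qquad |R|\le\rho^{-4}.$$ In particular, for fixed $x_0$ with $\mathbb J_{x_0}(-x_0)\neq0$, one has $H(x_0,\rho)\sim\frac1{\rho^2}\mathbb J_{x_0}(-x_0)$ as $\rho\to\infty$ (that is, the ratio of the two sides tends to $1$).
   Context: The restricted Good function is defined for $x\in\mathbb R$ and $\rho>0$ by $$H(x,\rho):=\frac1\pi\int_0^\pi\frac{\cos\big(x(\theta+\sin\theta)\big)}{\rho^2+\sin^2\theta}\,d\theta .$$ Anger's function is $\mathbb J_\gamma(x):=\frac1\pi\int_0^\pi\cos(\gamma\theta-x\sin\theta)\,d\theta$ for real $\gamma,x$. *)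

theory Defs
  imports "HOL-Analysis.Analysis" "HOL-Library.Landau_Symbols"
begin

text \<open>Restricted Good function, intended for \<open>\<rho> > 0\<close>; the integrand is then continuous in \<open>\<theta>\<close>,
  so the Henstock-Kurzweil integral is the Riemann integral.\<close>

definition good_H :: "real \<Rightarrow> real \<Rightarrow> real" where
  "good_H x \<rho> =
     1 / pi * integral {0..pi} (\<lambda>\<theta>. cos (x * (\<theta> + sin \<theta>)) / (\<rho>\<^sup>2 + (sin \<theta>)\<^sup>2))"

text \<open>Anger's function of real order \<open>\<gamma>\<close>; the order is the first argument.\<close>

definition anger_J :: "real \<Rightarrow> real \<Rightarrow> real" where
  "anger_J \<gamma> x = 1 / pi * integral {0..pi} (\<lambda>\<theta>. cos (\<gamma> * \<theta> - x * sin \<theta>))"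

end

theory Submission
  imports Defs "HOL-Real_Asymp.Real_Asymp"
begin

text \<open>With order \<open>x\<close> and argument \<open>- x\<close>, Anger's phase is
  \<open>x * \<theta> + x * sin \<theta>\<close>, exactly the phase in the restricted Good function.
  The two sides therefore differ only in the weight:
  \<open>1 / (\<rho>\<^sup>2 + (sin \<theta>)\<^sup>2)\<close> against its
  large-\<open>\<rho>\<close> limit form \<open>1 / \<rho>\<^sup>2\<close>. These weights differ by
  at most \<open>1 / \<rho> ^ 4\<close> (\<open>abs_cos_div_diff_le\<close>), and averaging over
  \<open>{0..pi}\<close> preserves this bound (\<open>good_H_minus_anger_J_le\<close>). The error is
  thus of smaller order than a nonzero multiple of \<open>1 / \<rho>\<^sup>2\<close>, which gives
  the asymptotic equivalence.\<close>

lemma abs_cos_div_diff_le: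
  fixes c s \<rho> :: real
  assumes "\<rho> > 0" "\<bar>s\<bar> \<le> 1"
  shows "\<bar>cos c / (\<rho>\<^sup>2 + s\<^sup>2) - 1 / \<rho>\<^sup>2 * cos c\<bar> \<le> 1 / \<rho> ^ 4"
proof -
  have pos: "\<rho>\<^sup>2 > 0" "\<rho>\<^sup>2 + s\<^sup>2 > 0"
    using assms by (auto intro: add_pos_nonneg)
  have s2: "s\<^sup>2 \<le> 1"
    using assms(2) by (simp add: abs_square_le_1)
  have "cos c / (\<rho>\<^sup>2 + s\<^sup>2) - 1 / \<rho>\<^sup>2 * cos c = - (cos c * s\<^sup>2 / (\<rho>\<^sup>2 * (\<rho>\<^sup>2 + s\<^sup>2)))"
    using pos by (simp add: divide_simps) (simp add: algebra_simps)
  hence "\<bar>cos c / (\<rho>\<^sup>2 + s\<^sup>2) - 1 / \<rho>\<^sup>2 * cos c\<bar> = \<bar>cos c\<bar> * s\<^sup>2 / (\<rho>\<^sup>2 * (\<rho>\<^sup>2 + s\<^sup>2))"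
    using pos by (simp add: abs_mult)
  \<comment> \<open>The numerator is at most 1, and dropping \<open>s\<^sup>2\<close> shrinks the
    denominator.\<close>
  also have "\<dots> \<le> 1 / (\<rho>\<^sup>2 * \<rho>\<^sup>2)"
    using pos s2 by (intro frac_le mult_left_mono mult_le_one) auto
  finally show ?thesis
    by (simp flip: power_add)
qed

text \<open>The pointwise estimate is uniform in \<theta>, so it survives taking the mean. This one
  inequality supplies both the explicit remainder and the limit statement.\<close>

lemma good_H_minus_anger_J_le:
  assumes "\<rho> > 0"
  shows "\<bar>good_H x \<rho> - 1 / \<rho>\<^sup>2 * anger_J x (- x)\<bar> \<le> 1 / \<rho> ^ 4"
proof -
  define f where "f = (\<lambda>\<theta>. cos (x * (\<theta> + sin \<theta>)) / (\<rho>\<^sup>2 + (sin \<theta>)\<^sup>2))"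
  define g where "g = (\<lambda>\<theta>. cos (x * (\<theta> + sin \<theta>)))"
  have ne: "\<rho>\<^sup>2 + (sin \<theta>)\<^sup>2 \<noteq> 0" for \<theta>
    using assms by (simp add: sum_power2_eq_zero_iff)
  have f: "f integrable_on {0..pi}"
    unfolding f_def by (intro integrable_continuous_real continuous_intros) (use ne in auto)
  have g: "g integrable_on {0..pi}"
    unfolding g_def by (intro integrable_continuous_real continuous_intros)
  have h: "(\<lambda>\<theta>. f \<theta> - 1 / \<rho>\<^sup>2 * g \<theta>) integrable_on {0..pi}"
    using f integrable_on_mult_right[OF g] by (rule integrable_diff)
  \<comment> \<open>The double sign in \<open>x * \<theta> - (- x) * sin \<theta>\<close> turns
    Anger's integrand into \<open>g\<close>.\<close>
  have "good_H x \<rho> - 1 / \<rho>\<^sup>2 * anger_J x (- x)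
      = 1 / pi * (integral {0..pi} f - 1 / \<rho>\<^sup>2 * integral {0..pi} g)"
    by (simp add: good_H_def anger_J_def f_def g_def algebra_simps)
  also have "\<dots> = 1 / pi * integral {0..pi} (\<lambda>\<theta>. f \<theta> - 1 / \<rho>\<^sup>2 * g \<theta>)"
    using integral_diff[OF f integrable_on_mult_right[OF g]] integral_mult_right by metis
  finally have eq: "good_H x \<rho> - 1 / \<rho>\<^sup>2 * anger_J x (- x)
      = 1 / pi * integral {0..pi} (\<lambda>\<theta>. f \<theta> - 1 / \<rho>\<^sup>2 * g \<theta>)" .
  \<comment> \<open>The constant bound integrates to \<open>pi / \<rho> ^ 4\<close>; the prefactor
    \<open>1 / pi\<close> later cancels the length of the interval.\<close>
  have "norm (integral {0..pi} (\<lambda>\<theta>. f \<theta> - 1 / \<rho>\<^sup>2 * g \<theta>)) \<le> integral {0..pi} (\<lambda>_. 1 / \<rho> ^ 4)"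
    using h
  proof (rule integral_norm_bound_integral)
    fix \<theta> :: real
    show "norm (f \<theta> - 1 / \<rho>\<^sup>2 * g \<theta>) \<le> 1 / \<rho> ^ 4"
      unfolding f_def g_def real_norm_def using assms by (intro abs_cos_div_diff_le) auto
  qed auto
  hence "\<bar>integral {0..pi} (\<lambda>\<theta>. f \<theta> - 1 / \<rho>\<^sup>2 * g \<theta>)\<bar> \<le> 1 / \<rho> ^ 4 * pi"
    by simp
  thus ?thesis
    unfolding eq by (simp only: abs_mult) (simp add: pos_divide_le_eq)
qed

theorem proposition1p2:
  fixes x\<^sub>0 :: real
  shows "(\<forall>\<rho>::real. \<rho> > 4 / pi \<longrightarrow>
            (\<exists>R::real. good_H x\<^sub>0 \<rho> = 1 / \<rho>\<^sup>2 * anger_J x\<^sub>0 (- x\<^sub>0) + R \<and> \<bar>R\<bar> \<le> 1 / \<rho> ^ 4)) \<and>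
         (anger_J x\<^sub>0 (- x\<^sub>0) \<noteq> 0 \<longrightarrow>
            (\<lambda>\<rho>::real. good_H x\<^sub>0 \<rho>) \<sim>[at_top] (\<lambda>\<rho>. 1 / \<rho>\<^sup>2 * anger_J x\<^sub>0 (- x\<^sub>0)))"
proof (intro conjI allI impI)
  fix \<rho> :: real
  assume "\<rho> > 4 / pi"
  moreover have "4 / pi > 0"
    by simp
  ultimately have "\<rho> > 0"
    by linarith
  from good_H_minus_anger_J_le[OF this]
  show "\<exists>R. good_H x\<^sub>0 \<rho> = 1 / \<rho>\<^sup>2 * anger_J x\<^sub>0 (- x\<^sub>0) + R \<and> \<bar>R\<bar> \<le> 1 / \<rho> ^ 4"
    by (intro exI[of _ "good_H x\<^sub>0 \<rho> - 1 / \<rho>\<^sup>2 * anger_J x\<^sub>0 (- x\<^sub>0)"]) simp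
next
  assume nz: "anger_J x\<^sub>0 (- x\<^sub>0) \<noteq> 0"
  have "(\<lambda>\<rho>. good_H x\<^sub>0 \<rho> - 1 / \<rho>\<^sup>2 * anger_J x\<^sub>0 (- x\<^sub>0)) \<in> O(\<lambda>\<rho>. 1 / \<rho> ^ 4)"
  proof (rule bigoI[where c = 1])
    show "\<forall>\<^sub>F \<rho> in at_top. norm (good_H x\<^sub>0 \<rho> - 1 / \<rho>\<^sup>2 * anger_J x\<^sub>0 (- x\<^sub>0)) \<le> 1 * norm (1 / \<rho> ^ 4)"
      using eventually_gt_at_top[of 0]
      by eventually_elim (use good_H_minus_anger_J_le[of _ x\<^sub>0] in simp)
  qed
  \<comment> \<open>The quotient of the two functions is a constant times
    \<open>1 / \<rho>\<^sup>2\<close>; \<open>nz\<close> keeps that constant finite.\<close>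
  also have "(\<lambda>\<rho>::real. 1 / \<rho> ^ 4) \<in> o(\<lambda>\<rho>. 1 / \<rho>\<^sup>2 * anger_J x\<^sub>0 (- x\<^sub>0))"
    using nz by real_asymp
  finally show "(\<lambda>\<rho>. good_H x\<^sub>0 \<rho>) \<sim>[at_top] (\<lambda>\<rho>. 1 / \<rho>\<^sup>2 * anger_J x\<^sub>0 (- x\<^sub>0))"
    \<comment> \<open>Equivalence of two functions means that their difference is little-o of the
      second.\<close>
    by (simp add: asymp_equiv_altdef)
qed

end
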